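(* Let $P(\lambda)=\sum_{j=0}^m A_j\lambda^j$ be an $n\times n$ matrix polynomial with $A_j\in\mathbb{C}^{n\times n}$, $m\ge 1$ and $\det A_m\ne 0$, and let $w_0>0$, $w_1,\dots,w_m\ge 0$ be given weights, with $w(\lambda)=w_m\lambda^m+\cdots+w_1\lambda+w_0$. Let $\sigma(P)=\{\lambda_1,\lambda_2,\dots,\lambda_{nm}\}$ be the spectrum of $P(\lambda)$, counting algebraic multiplicities. If $\lambda_i$ is a simple eigenvalue, then $$k(P,\lambda_i)=\frac{w(|\lambda_i|)\,\|\mathrm{adj}(P(\lambda_i))\|}{|\det A_m|\,\prod_{j\ne i}|\lambda_j-\lambda_i|}.$$
   Context: $\|\cdot\|$ is the spectral matrix norm (Euclidean norm for vectors), and $\mathrm{adj}(\cdot)$ denotes the adjugate of a matrix. The eigenvalues of $P$ are the zeros of the scalar polynomial $\det P(\lambda)$ (of degree $nm$), and the algebraic multiplicity of an eigenvalue is its multiplicity as a zero of $\det P(\lambda)$; an eigenvalue is simple if its algebraic multiplicity is $1$. For a simple eigenvalue $\lambda_0$ of $P$ with right eigenvector $x_0$ (nonzero, $P(\lambda_0)x_0=0$) and left eigenvector $y_0$ (nonzero, $y_0^*P(\lambda_0)=0$), both unique up to scaling, the condition number of $\lambda_0$ is $$k(P,\lambda_0)=\frac{w(|\lambda_0|)\,\|x_0\|\,\|y_0\|}{|y_0^*P'(\lambda_0)x_0|},$$ where $P'$ is the derivative of $P$ with respect to $\lambda$. *)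

theory Defs
  imports
    "HOL-Analysis.L2_Norm"
    "Jordan_Normal_Form.Matrix"
    "Jordan_Normal_Form.Determinant"
begin

text \<open>
  A matrix polynomial is a matrix whose entries are scalar polynomials, so \<open>det P\<close> is itself a
  polynomial in the indeterminate; the \<open>A j\<close> below are its matrix coefficients.
\<close>

definition matpoly :: "nat \<Rightarrow> nat \<Rightarrow> (nat \<Rightarrow> complex mat) \<Rightarrow> complex poly mat" where
  "matpoly n m A = mat n n (\<lambda>(r, c). \<Sum>j\<le>m. monom (A j $$ (r, c)) j)"

definition matpoly_eval :: "complex poly mat \<Rightarrow> complex \<Rightarrow> complex mat" where
  "matpoly_eval P z = map_mat (\<lambda>p. poly p z) P"

definition matpoly_deriv :: "complex poly mat \<Rightarrow> complex poly mat" where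
  "matpoly_deriv P = map_mat pderiv P"

lemma matpoly_eval_matpoly:
  "matpoly_eval (matpoly n m A) z = mat n n (\<lambda>(r, c). \<Sum>j\<le>m. A j $$ (r, c) * z ^ j)"
  by (rule eq_matI) (simp_all add: matpoly_eval_def matpoly_def poly_sum poly_monom)

definition matpoly_eigenvalue :: "complex poly mat \<Rightarrow> complex \<Rightarrow> bool" where
  "matpoly_eigenvalue P z \<longleftrightarrow> poly (det P) z = 0"

definition matpoly_simple_eigenvalue :: "complex poly mat \<Rightarrow> complex \<Rightarrow> bool" where
  "matpoly_simple_eigenvalue P z \<longleftrightarrow> matpoly_eigenvalue P z \<and> order z (det P) = 1"

text \<open>The zeros of \<open>det P\<close>, each repeated according to its multiplicity.\<close>

definition matpoly_spectrum :: "complex poly mat \<Rightarrow> complex multiset" where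
  "matpoly_spectrum P = proots (det P)"

definition right_eigenvector :: "complex poly mat \<Rightarrow> complex \<Rightarrow> complex vec \<Rightarrow> bool" where
  "right_eigenvector P z x \<longleftrightarrow>
     x \<in> carrier_vec (dim_col P) \<and> x \<noteq> 0\<^sub>v (dim_col P) \<and>
     matpoly_eval P z *\<^sub>v x = 0\<^sub>v (dim_row P)"

text \<open>The row matrix \<open>mat_of_row (conjugate y)\<close> is the conjugate transpose of the column \<open>y\<close>.\<close>

definition left_eigenvector :: "complex poly mat \<Rightarrow> complex \<Rightarrow> complex vec \<Rightarrow> bool" where
  "left_eigenvector P z y \<longleftrightarrow>
     y \<in> carrier_vec (dim_row P) \<and> y \<noteq> 0\<^sub>v (dim_row P) \<and>
     mat_of_row (conjugate y) * matpoly_eval P z = 0\<^sub>m 1 (dim_col P)"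

definition vec_norm2 :: "complex vec \<Rightarrow> real" where
  "vec_norm2 v = L2_set (\<lambda>i. cmod (v $ i)) {..<dim_vec v}"

text \<open>
  The operator norm induced by the Euclidean norm. The supremum is over a nonempty set only if
  \<open>A\<close> has at least one column.
\<close>

definition spectral_norm :: "complex mat \<Rightarrow> real" where
  "spectral_norm A =
     (SUP v \<in> {v \<in> carrier_vec (dim_col A). vec_norm2 v = 1}. vec_norm2 (A *\<^sub>v v))"

definition weight_poly :: "nat \<Rightarrow> (nat \<Rightarrow> real) \<Rightarrow> real \<Rightarrow> real" where
  "weight_poly m w t = (\<Sum>j\<le>m. w j * t ^ j)"

text \<open>
  The condition number of a simple eigenvalue \<open>z\<close>, computed from a right eigenvector \<open>x\<close> and a left
  eigenvector \<open>y\<close>. These are explicit arguments since they are unique only up to scaling.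
\<close>

definition cond_number ::
  "nat \<Rightarrow> (nat \<Rightarrow> real) \<Rightarrow> complex poly mat \<Rightarrow> complex \<Rightarrow> complex vec \<Rightarrow> complex vec \<Rightarrow> real" where
  "cond_number m w P z x y =
     weight_poly m w (cmod z) * vec_norm2 x * vec_norm2 y /
     cmod (conjugate y \<bullet> (matpoly_eval (matpoly_deriv P) z *\<^sub>v x))"

lemma det_matpoly_eval:
  assumes "P \<in> carrier_mat n n"
  shows "det (matpoly_eval P z) = poly (det P) z"
proof -
  interpret comm_ring_hom "\<lambda>p :: complex poly. poly p z"
    by unfold_locales simp_all
  show ?thesis by (simp add: matpoly_eval_def)
qed

lemma right_eigenvector_exists:
  assumes P: "P \<in> carrier_mat n n" and z: "matpoly_eigenvalue P z"
  shows "\<exists>x. right_eigenvector P z x"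
proof -
  have E: "matpoly_eval P z \<in> carrier_mat n n"
    using P by (simp add: matpoly_eval_def)
  have "det (matpoly_eval P z) = 0"
    using z by (simp add: det_matpoly_eval[OF P] matpoly_eigenvalue_def)
  then show ?thesis
    using P det_0_iff_vec_prod_zero[OF E] by (auto simp: right_eigenvector_def)
qed

lemma left_eigenvector_exists:
  assumes P: "P \<in> carrier_mat n n" and z: "matpoly_eigenvalue P z"
  shows "\<exists>y. left_eigenvector P z y"
proof -
  let ?E = "matpoly_eval P z"
  have E: "?E \<in> carrier_mat n n"
    using P by (simp add: matpoly_eval_def)
  have "det ?E\<^sup>T = 0"
    using z by (simp add: det_transpose[OF E] det_matpoly_eval[OF P] matpoly_eigenvalue_def)
  then obtain v where v: "v \<in> carrier_vec n" "v \<noteq> 0\<^sub>v n" and Ev: "?E\<^sup>T *\<^sub>v v = 0\<^sub>v n"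
    using det_0_iff_vec_prod_zero[of "?E\<^sup>T" n] E by auto
  have "v \<bullet> col ?E j = 0" if j: "j < n" for j
  proof -
    have "(?E\<^sup>T *\<^sub>v v) $ j = col ?E j \<bullet> v"
      using E j by simp
    then show ?thesis
      using Ev j v E comm_scalar_prod[of v n "col ?E j"] by auto
  qed
  then have "mat_of_row v * ?E = 0\<^sub>m 1 n"
    using E v by (intro eq_matI) auto
  moreover have "conjugate v \<noteq> 0\<^sub>v n"
    using v by (metis conjugate_id conjugate_zero_vec)
  ultimately have "left_eigenvector P z (conjugate v)"
    using P v by (auto simp: left_eigenvector_def)
  then show ?thesis by blast
qed

end

theory Submission
  imports Defs "HOL-Computational_Algebra.Fundamental_Theorem_Algebra"
begin

text \<open>
  Write \<open>B\<close> for the adjugate of \<open>P(z)\<close> at a simple eigenvalue \<open>z\<close>. The formula holds because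
  \<open>B\<close> is the rank one matrix \<open>x y\<^sup>*\<close> times \<open>(det P)'(z) / (y\<^sup>* P'(z) x)\<close>: comparing spectral norms
  gives the condition number, once \<open>(det P)'(z)\<close> is expressed through the spectrum.

  First, \<open>P(z) B = 0\<close> forces every column of \<open>B\<close> into the kernel of \<open>P(z)\<close>. If \<open>B\<close> has a nonzero
  entry, then a cofactor of \<open>P(z)\<close> is nonzero and this kernel is the line spanned by \<open>x\<close>. Hence
  \<open>B = x b\<^sup>T\<close> for some \<open>b\<close> (lemma \<open>adj_mat_singular_columns\<close>). To find \<open>b\<close>, differentiate
  \<open>P adj(P) = det(P) I\<close> at \<open>z\<close> and multiply by \<open>y\<^sup>*\<close> from the left. As \<open>y\<^sup>* P(z) = 0\<close>, the derivative of
  the adjugate drops out, and \<open>(y\<^sup>* P'(z) x) b\<^sup>T = (det P)'(z) y\<^sup>*\<close> remains. Simplicity of \<open>z\<close> means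
  \<open>(det P)'(z) \<noteq> 0\<close>, so \<open>y\<^sup>* P'(z) x \<noteq> 0\<close> and
  \<open>B = (det P)'(z) / (y\<^sup>* P'(z) x) x y\<^sup>*\<close> (lemma \<open>adj_mat_simple_eigenvalue\<close>).
  The spectral norm of \<open>x y\<^sup>*\<close> is \<open>\<parallel>x\<parallel> \<parallel>y\<parallel>\<close>, by Cauchy-Schwarz (lemma \<open>spectral_norm_rank_one\<close>).

  As for \<open>(det P)'(z)\<close>, the Leibniz expansion shows that the leading coefficient of \<open>det P\<close> is the
  determinant of the leading matrix coefficient, and differentiating the factorisation of \<open>det P\<close>
  into linear factors expresses \<open>(det P)'(z)\<close> through the differences of the eigenvalues
  (lemmas \<open>lead_coeff_det_matpoly\<close> and \<open>poly_pderiv_at_root\<close>).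
\<close>

section \<open>The adjugate of a singular matrix\<close>

lemma det_replace_col_unit_vec:
  assumes A: "A \<in> carrier_mat n n" and r: "r < n" and k: "k < n"
  shows "det (replace_col A (unit_vec n r) k) = adj_mat A $$ (k, r)"
proof -
  let ?M = "replace_col A (unit_vec n r) k"
  have M: "?M \<in> carrier_mat n n"
    using A by (simp add: replace_col_def)
  have cof: "cofactor ?M s k = cofactor A s k" if "s < n" for s
  proof -
    have "mat_delete ?M s k = mat_delete A s k"
      using A that k by (intro eq_matI) (auto simp: mat_delete_def replace_col_def)
    then show ?thesis
      by (simp add: cofactor_def)
  qed
  have "det ?M = (\<Sum>s<n. ?M $$ (s, k) * cofactor ?M s k)"
    by (rule laplace_expansion_column[OF M k])
  also have "\<dots> = (\<Sum>s<n. if s = r then cofactor A s k else 0)"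
  proof (rule sum.cong[OF refl])
    fix s
    assume "s \<in> {..<n}"
    then show "?M $$ (s, k) * cofactor ?M s k = (if s = r then cofactor A s k else 0)"
      using A r k by (subst cof) (auto simp: replace_col_def)
  qed
  also have "\<dots> = adj_mat A $$ (k, r)"
    using A r k by (simp add: adj_mat_def)
  finally show ?thesis .
qed

text \<open>
  A kernel vector that vanishes at \<open>k\<close> does not see column \<open>k\<close>, so it stays in the kernel when this
  column is replaced by a unit vector. The determinant of the new matrix is a cofactor in
  column \<open>k\<close> of \<open>A\<close>, that is, an entry in row \<open>k\<close> of the adjugate.
\<close>

lemma kernel_vec_eq_0:
  fixes A :: "'a::idom mat"
  assumes A: "A \<in> carrier_mat n n" and r: "r < n" and k: "k < n"
    and adj: "adj_mat A $$ (k, r) \<noteq> 0"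
    and v: "v \<in> carrier_vec n" and Av: "A *\<^sub>v v = 0\<^sub>v n" and vk: "v $ k = 0"
  shows "v = 0\<^sub>v n"
proof -
  let ?M = "replace_col A (unit_vec n r) k"
  have M: "?M \<in> carrier_mat n n"
    using A by (simp add: replace_col_def)
  have "?M *\<^sub>v v = A *\<^sub>v v"
    using A v vk
    by (intro eq_vecI) (auto simp: replace_col_def scalar_prod_def intro!: sum.cong)
  then have "?M *\<^sub>v v = 0\<^sub>v n"
    using Av by simp
  moreover have "det ?M \<noteq> 0"
    using adj by (simp add: det_replace_col_unit_vec[OF A r k])
  ultimately show ?thesis
    using det_0_iff_vec_prod_zero[OF M] v by blast
qed

text \<open>
  The adjugate of a singular matrix has rank at most one. If its entry at \<open>(k, r)\<close> is nonzero, then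
  \<open>x $ k\<close> is nonzero, and every column of the adjugate becomes, after subtracting a multiple of \<open>x\<close>,
  a kernel vector that vanishes at \<open>k\<close>, hence zero.
\<close>

lemma adj_mat_singular_columns:
  fixes A :: "'a::field mat"
  assumes A: "A \<in> carrier_mat n n" and det0: "det A = 0"
    and x: "x \<in> carrier_vec n" "x \<noteq> 0\<^sub>v n" and Ax: "A *\<^sub>v x = 0\<^sub>v n"
  shows "\<exists>b. \<forall>i<n. \<forall>j<n. adj_mat A $$ (i, j) = x $ i * b j"
proof (cases "\<exists>k<n. \<exists>r<n. adj_mat A $$ (k, r) \<noteq> 0")
  case False
  then show ?thesis by (intro exI[of _ "\<lambda>_. 0"]) auto
next
  case True
  then obtain k r where kr: "k < n" "r < n" "adj_mat A $$ (k, r) \<noteq> 0"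
    by blast
  let ?B = "adj_mat A"
  note B = adj_mat(1)[OF A]
  have xk: "x $ k \<noteq> 0"
    using kernel_vec_eq_0[OF A kr(2,1,3) x(1) Ax] x(2) by blast
  have "?B $$ (i, j) = x $ i * (?B $$ (k, j) / x $ k)" if ij: "i < n" "j < n" for i j
  proof -
    define v where "v = x $ k \<cdot>\<^sub>v col ?B j - ?B $$ (k, j) \<cdot>\<^sub>v x"
    have cB: "col ?B j \<in> carrier_vec n"
      using B by auto
    have v: "v \<in> carrier_vec n"
      using x cB by (simp add: v_def)
    have "A *\<^sub>v col ?B j = col (A * ?B) j"
      using col_mult2[OF A B ij(2)] by simp
    also have "\<dots> = 0\<^sub>v n"
      using ij A by (intro eq_vecI) (auto simp: adj_mat(2)[OF A] det0)
    finally have AB: "A *\<^sub>v col ?B j = 0\<^sub>v n" .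
    have "A *\<^sub>v v = x $ k \<cdot>\<^sub>v (A *\<^sub>v col ?B j) - ?B $$ (k, j) \<cdot>\<^sub>v (A *\<^sub>v x)"
      unfolding v_def using A x cB
      by (simp add: mult_minus_distrib_mat_vec[of A n n] mult_mat_vec[of A n n])
    then have "A *\<^sub>v v = 0\<^sub>v n"
      unfolding AB Ax by (auto intro: eq_vecI)
    moreover have "v $ k = 0"
      using B x ij kr by (simp add: v_def)
    ultimately have "v = 0\<^sub>v n"
      using kernel_vec_eq_0[OF A kr(2,1,3) v] by blast
    then have "v $ i = 0"
      using ij by simp
    then show ?thesis
      using B x ij kr xk by (simp add: v_def field_simps)
  qed
  then show ?thesis
    by (intro exI[of _ "\<lambda>j. ?B $$ (k, j) / x $ k"]) blast
qed

section \<open>Evaluation and differentiation of matrix polynomials\<close>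

lemma matpoly_eval_carrier [simp]:
  "P \<in> carrier_mat n n \<Longrightarrow> matpoly_eval P z \<in> carrier_mat n n"
  by (simp add: matpoly_eval_def)

lemma matpoly_deriv_carrier [simp]:
  "P \<in> carrier_mat n n \<Longrightarrow> matpoly_deriv P \<in> carrier_mat n n"
  by (simp add: matpoly_deriv_def)

lemma adj_mat_matpoly_eval:
  assumes P: "P \<in> carrier_mat n n"
  shows "adj_mat (matpoly_eval P z) = matpoly_eval (adj_mat P) z"
proof (rule eq_matI)
  fix i j
  assume "i < dim_row (matpoly_eval (adj_mat P) z)" "j < dim_col (matpoly_eval (adj_mat P) z)"
  then have ij: "i < n" "j < n"
    using adj_mat(1)[OF P] by (auto simp: matpoly_eval_def)
  have "mat_delete P j i \<in> carrier_mat (n - 1) (n - 1)"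
    using P ij by (intro mat_delete_carrier)
  note det = det_matpoly_eval[OF this]
  have "mat_delete (matpoly_eval P z) j i = matpoly_eval (mat_delete P j i) z"
    using P ij by (intro eq_matI) (auto simp: mat_delete_def matpoly_eval_def)
  then show "adj_mat (matpoly_eval P z) $$ (i, j) = matpoly_eval (adj_mat P) z $$ (i, j)"
    using P ij det by (simp add: adj_mat_def cofactor_def matpoly_eval_def poly_power)
qed (use P in \<open>auto simp: adj_mat_def matpoly_eval_def\<close>)

lemma pderiv_sum: "pderiv (sum f S) = (\<Sum>k\<in>S. pderiv (f k))"
  by (induction S rule: infinite_finite_induct) (simp_all add: pderiv_add)

lemma matpoly_eval_deriv_mult:
  assumes F: "F \<in> carrier_mat n n" and G: "G \<in> carrier_mat n n"
  shows "matpoly_eval (matpoly_deriv (F * G)) z =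
    matpoly_eval (matpoly_deriv F) z * matpoly_eval G z +
    matpoly_eval F z * matpoly_eval (matpoly_deriv G) z"
  using assms
  by (intro eq_matI)
    (auto simp: matpoly_eval_def matpoly_deriv_def scalar_prod_def pderiv_sum pderiv_mult
      poly_sum sum.distrib[symmetric] algebra_simps intro!: sum.cong)

text \<open>The derivative at \<open>z\<close> of the identity \<open>P adj(P) = det(P) I\<close> of matrix polynomials.\<close>

lemma matpoly_adj_deriv:
  assumes P: "P \<in> carrier_mat n n"
  shows "matpoly_eval (matpoly_deriv P) z * adj_mat (matpoly_eval P z) +
    matpoly_eval P z * matpoly_eval (matpoly_deriv (adj_mat P)) z =
    poly (pderiv (det P)) z \<cdot>\<^sub>m 1\<^sub>m n"
proof -
  have "matpoly_eval (matpoly_deriv (P * adj_mat P)) z = poly (pderiv (det P)) z \<cdot>\<^sub>m 1\<^sub>m n"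
    unfolding adj_mat(2)[OF P]
    by (intro eq_matI) (auto simp: matpoly_eval_def matpoly_deriv_def pderiv_mult)
  then show ?thesis
    using matpoly_eval_deriv_mult[OF P adj_mat(1)[OF P], of z] adj_mat_matpoly_eval[OF P, of z]
    by simp
qed

text \<open>
  The column \<open>x\<close> is determined by the kernel of \<open>P(z)\<close>, the row \<open>y\<^sup>*\<close> by the differentiated adjugate
  identity. The latter also gives \<open>s \<noteq> 0\<close>: otherwise \<open>(det P)'(z) y\<^sup>* = 0\<close>.
\<close>

lemma adj_mat_simple_eigenvalue:
  fixes P :: "complex poly mat"
  assumes P: "P \<in> carrier_mat n n"
    and ev: "matpoly_eigenvalue P z"
    and d: "poly (pderiv (det P)) z \<noteq> 0"
    and x: "right_eigenvector P z x" and y: "left_eigenvector P z y"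
  defines "s \<equiv> conjugate y \<bullet> (matpoly_eval (matpoly_deriv P) z *\<^sub>v x)"
  shows "s \<noteq> 0"
    and "adj_mat (matpoly_eval P z) =
      mat n n (\<lambda>(i, j). poly (pderiv (det P)) z / s * x $ i * cnj (y $ j))"
proof -
  define E where "E = matpoly_eval P z"
  define E' where "E' = matpoly_eval (matpoly_deriv P) z"
  define B where "B = adj_mat E"
  define B' where "B' = matpoly_eval (matpoly_deriv (adj_mat P)) z"
  define d' where "d' = poly (pderiv (det P)) z"
  define Y where "Y = mat_of_row (conjugate y)"
  have carr: "E \<in> carrier_mat n n" "E' \<in> carrier_mat n n" "B \<in> carrier_mat n n"
    "B' \<in> carrier_mat n n"
    using P adj_mat(1)[OF P] adj_mat(1)[of E n] by (auto simp: E_def E'_def B_def B'_def)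
  have xc: "x \<in> carrier_vec n" "x \<noteq> 0\<^sub>v n" "E *\<^sub>v x = 0\<^sub>v n"
    using x P by (auto simp: right_eigenvector_def E_def)
  have yc: "y \<in> carrier_vec n" "y \<noteq> 0\<^sub>v n" and YE: "Y * E = 0\<^sub>m 1 n"
    using y P by (auto simp: left_eigenvector_def E_def Y_def)
  have Y: "Y \<in> carrier_mat 1 n"
    using yc by (simp add: Y_def)
  have "det E = 0"
    using ev by (simp add: E_def det_matpoly_eval[OF P] matpoly_eigenvalue_def)
  then obtain b where b: "\<And>i j. i < n \<Longrightarrow> j < n \<Longrightarrow> B $$ (i, j) = x $ i * b j"
    using adj_mat_singular_columns[OF carr(1) _ xc] unfolding B_def by blast
  \<comment> \<open>Multiplying the differentiated identity by \<open>y\<^sup>*\<close> removes the unknown derivative of the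
    adjugate.\<close>
  have key: "E' * B + E * B' = d' \<cdot>\<^sub>m 1\<^sub>m n"
    using matpoly_adj_deriv[OF P, of z] by (simp add: E_def E'_def B_def B'_def d'_def)
  have "Y * (E' * B) = Y * (E' * B) + (Y * E) * B'"
    using Y carr by (simp add: YE left_mult_zero_mat[OF carr(4)] right_add_zero_mat[of _ 1 n])
  also have "\<dots> = Y * (E' * B + E * B')"
    using Y carr
    by (simp add: mult_add_distrib_mat[of Y 1 n _ n] assoc_mult_mat[of Y 1 n E n B' n])
  also have "\<dots> = d' \<cdot>\<^sub>m Y"
    unfolding key using Y by (simp add: mult_smult_distrib[OF Y one_carrier_mat])
  finally have YEB: "Y * (E' * B) = d' \<cdot>\<^sub>m Y" .
  have sb: "s * b j = d' * cnj (y $ j)" if j: "j < n" for j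
  proof -
    have c: "col B j = b j \<cdot>\<^sub>v x"
      using carr xc j by (intro eq_vecI) (auto simp: b)
    have "(Y * (E' * B)) $$ (0, j) = conjugate y \<bullet> (E' *\<^sub>v col B j)"
      using Y carr j yc col_mult2[OF carr(2,3) j] by (simp add: Y_def)
    also have "\<dots> = s * b j"
      unfolding c s_def E'_def[symmetric] using carr(2) xc yc
      by (simp add: mult_mat_vec[of E' n n] scalar_prod_smult_right)
    finally show ?thesis
      using YEB Y yc j by (simp add: Y_def)
  qed
  show s: "s \<noteq> 0"
  proof
    assume "s = 0"
    then have "y $ j = 0" if "j < n" for j
      using sb[OF that] d by (simp add: d'_def)
    then have "y = 0\<^sub>v n"
      using yc by (intro eq_vecI) auto
    then show False
      using yc by blast
  qed
  have "b j = d' / s * cnj (y $ j)" if "j < n" for j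
    using sb[OF that] s by (simp add: field_simps)
  then have "B = mat n n (\<lambda>(i, j). d' / s * x $ i * cnj (y $ j))"
    using carr by (intro eq_matI) (auto simp: b)
  then show "adj_mat (matpoly_eval P z) =
      mat n n (\<lambda>(i, j). poly (pderiv (det P)) z / s * x $ i * cnj (y $ j))"
    by (simp add: B_def E_def d'_def)
qed

section \<open>The spectral norm of a matrix of rank one\<close>

lemma vec_norm2_smult: "vec_norm2 (c \<cdot>\<^sub>v v) = cmod c * vec_norm2 v"
proof -
  have "vec_norm2 (c \<cdot>\<^sub>v v) = L2_set (\<lambda>i. cmod c * cmod (v $ i)) {..<dim_vec v}"
    unfolding vec_norm2_def by (intro L2_set_cong) (auto simp: norm_mult)
  then show ?thesis
    by (simp add: vec_norm2_def L2_set_right_distrib)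
qed

lemma vec_norm2_pos:
  assumes "v \<in> carrier_vec n" "v \<noteq> 0\<^sub>v n"
  shows "vec_norm2 v > 0"
proof -
  obtain j where "j < n" "v $ j \<noteq> 0"
    using assms by (metis carrier_vecD eq_vecI index_zero_vec)
  then have "vec_norm2 v \<noteq> 0"
    using assms by (auto simp: vec_norm2_def L2_set_eq_0_iff)
  then show ?thesis
    by (simp add: vec_norm2_def L2_set_nonneg order_less_le)
qed

lemma spectral_norm_rank_one:
  assumes x: "x \<in> carrier_vec n" and y: "y \<in> carrier_vec n" "y \<noteq> 0\<^sub>v n"
  shows "spectral_norm (mat n n (\<lambda>(i, j). c * x $ i * cnj (y $ j))) =
    cmod c * vec_norm2 x * vec_norm2 y"
proof -
  define B where "B = mat n n (\<lambda>(i, j). c * x $ i * cnj (y $ j))"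
  define q where "q v = (\<Sum>j<n. cnj (y $ j) * v $ j)" for v
  have Bv: "vec_norm2 (B *\<^sub>v v) = cmod c * vec_norm2 x * cmod (q v)" if "v \<in> carrier_vec n" for v
  proof -
    have "B *\<^sub>v v = (c * q v) \<cdot>\<^sub>v x"
      using that x
      by (intro eq_vecI)
        (auto simp: B_def q_def scalar_prod_def sum_distrib_left sum_distrib_right mult_ac
          atLeast0LessThan intro!: sum.cong)
    then show ?thesis
      by (simp add: vec_norm2_smult norm_mult)
  qed
  have qle: "cmod (q v) \<le> vec_norm2 y * vec_norm2 v" if "v \<in> carrier_vec n" for v
  proof -
    have "cmod (q v) \<le> (\<Sum>j<n. \<bar>cmod (y $ j)\<bar> * \<bar>cmod (v $ j)\<bar>)"
      unfolding q_def by (rule order_trans[OF norm_sum]) (simp add: norm_mult)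
    also have "\<dots> \<le> vec_norm2 y * vec_norm2 v"
      using L2_set_mult_ineq[of "\<lambda>j. cmod (y $ j)" "\<lambda>j. cmod (v $ j)" "{..<n}"] that y
      by (simp add: vec_norm2_def)
    finally show ?thesis .
  qed
  have qy: "q y = complex_of_real ((vec_norm2 y)\<^sup>2)"
  proof -
    have "q y = (\<Sum>j<n. complex_of_real ((cmod (y $ j))\<^sup>2))"
      unfolding q_def complex_norm_square by (simp add: mult.commute)
    then show ?thesis
      using y by (simp add: vec_norm2_def L2_set_def sum_nonneg)
  qed
  have ypos: "vec_norm2 y > 0"
    using y by (rule vec_norm2_pos)
  \<comment> \<open>The Cauchy-Schwarz bound is attained at the unit vector in the direction of \<open>y\<close>.\<close>
  define u where "u = complex_of_real (1 / vec_norm2 y) \<cdot>\<^sub>v y"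
  have u: "u \<in> carrier_vec n" "vec_norm2 u = 1"
    using y ypos by (auto simp: u_def vec_norm2_smult norm_divide)
  have "q u = complex_of_real (1 / vec_norm2 y) * q y"
    using y by (simp add: q_def u_def sum_distrib_left mult_ac)
  then have "q u = complex_of_real (vec_norm2 y)"
    using ypos by (simp add: qy power2_eq_square)
  then have qu: "cmod (q u) = vec_norm2 y"
    using ypos by simp
  have "(SUP v \<in> {v \<in> carrier_vec n. vec_norm2 v = 1}. vec_norm2 (B *\<^sub>v v)) =
    cmod c * vec_norm2 x * vec_norm2 y"
  proof (rule cSup_eq_maximum)
    have "cmod c * vec_norm2 x * vec_norm2 y = vec_norm2 (B *\<^sub>v u)"
      by (simp add: Bv u qu)
    then show "cmod c * vec_norm2 x * vec_norm2 y \<in>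
        (\<lambda>v. vec_norm2 (B *\<^sub>v v)) ` {v \<in> carrier_vec n. vec_norm2 v = 1}"
      using u by blast
  next
    fix t
    assume "t \<in> (\<lambda>v. vec_norm2 (B *\<^sub>v v)) ` {v \<in> carrier_vec n. vec_norm2 v = 1}"
    then obtain v where v: "v \<in> carrier_vec n" "vec_norm2 v = 1" "t = vec_norm2 (B *\<^sub>v v)"
      by blast
    have "cmod c * vec_norm2 x * cmod (q v) \<le> cmod c * vec_norm2 x * vec_norm2 y"
      using qle[OF v(1)] v(2)
      by (intro mult_left_mono) (auto simp: vec_norm2_def L2_set_nonneg)
    then show "t \<le> cmod c * vec_norm2 x * vec_norm2 y"
      by (simp add: v(3) Bv[OF v(1)])
  qed
  then show ?thesis
    unfolding B_def[symmetric] by (simp add: spectral_norm_def B_def)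
qed

section \<open>The determinant of a matrix polynomial and its derivative at a root\<close>

lemma coeff_mult_degree_bounds:
  fixes p q :: "'a::comm_semiring_1 poly"
  assumes p: "degree p \<le> a" and q: "degree q \<le> b"
  shows "coeff (p * q) (a + b) = coeff p a * coeff q b"
proof -
  have "coeff (p * q) (a + b) = (\<Sum>i\<le>a + b. if i = a then coeff p a * coeff q b else 0)"
    unfolding coeff_mult
  proof (rule sum.cong[OF refl])
    fix i
    show "coeff p i * coeff q (a + b - i) = (if i = a then coeff p a * coeff q b else 0)"
      using p q by (cases i a rule: linorder_cases) (auto simp: coeff_eq_0)
  qed
  then show ?thesis
    by simp
qed

lemma coeff_prod_degree_bound:
  fixes f :: "'i \<Rightarrow> 'a::comm_semiring_1 poly"
  assumes "finite S" and "\<And>i. i \<in> S \<Longrightarrow> degree (f i) \<le> m"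
  shows "degree (prod f S) \<le> card S * m \<and>
    coeff (prod f S) (card S * m) = (\<Prod>i\<in>S. coeff (f i) m)"
  using assms
proof (induction S rule: finite_induct)
  case empty
  then show ?case by simp
next
  case (insert i S)
  then have "degree (f i) \<le> m" "degree (prod f S) \<le> card S * m"
    "coeff (prod f S) (card S * m) = (\<Prod>i\<in>S. coeff (f i) m)"
    by auto
  then show ?case
    using insert.hyps coeff_mult_degree_bounds[of "f i" m "prod f S" "card S * m"]
      degree_mult_le[of "f i" "prod f S"]
    by auto
qed

text \<open>
  Every product in the Leibniz expansion has \<open>n\<close> factors of degree at most \<open>m\<close>, and its coefficient
  of degree \<open>n * m\<close> is the product of the coefficients of degree \<open>m\<close>.
\<close>

lemma degree_coeff_det_bound:
  fixes M :: "'a::comm_ring_1 poly mat"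
  assumes M: "M \<in> carrier_mat n n" and deg: "\<And>i j. i < n \<Longrightarrow> j < n \<Longrightarrow> degree (M $$ (i, j)) \<le> m"
  shows "degree (det M) \<le> n * m"
    and "coeff (det M) (n * m) = det (map_mat (\<lambda>p. coeff p m) M)"
proof -
  let ?f = "\<lambda>p. \<Prod>i = 0..<n. M $$ (i, p i)"
  have b: "degree (?f p) \<le> n * m \<and> coeff (?f p) (n * m) = (\<Prod>i = 0..<n. coeff (M $$ (i, p i)) m)"
    if "p permutes {0..<n}" for p
    using coeff_prod_degree_bound[of "{0..<n}" "\<lambda>i. M $$ (i, p i)" m] deg
      permutes_in_image[OF that]
    by auto
  have sgn: "signof p * q = smult (signof p) q" for p and q :: "'a poly"
    by (simp add: sign_def)
  have d: "det M = (\<Sum>p\<in>{p. p permutes {0..<n}}. smult (signof p) (?f p))"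
    unfolding det_def'[OF M] sgn ..
  show "degree (det M) \<le> n * m"
    unfolding d using b
    by (intro degree_sum_le) (auto simp: finite_permutations intro: order_trans[OF degree_smult_le])
  have "map_mat (\<lambda>p. coeff p m) M \<in> carrier_mat n n"
    using M by simp
  note d' = det_def'[OF this]
  show "coeff (det M) (n * m) = det (map_mat (\<lambda>p. coeff p m) M)"
    unfolding d d' coeff_sum coeff_smult
  proof (rule sum.cong[OF refl])
    fix p
    assume "p \<in> {p. p permutes {0..<n}}"
    then have p: "p permutes {0..<n}"
      by simp
    have "(\<Prod>i = 0..<n. coeff (M $$ (i, p i)) m) =
        (\<Prod>i = 0..<n. map_mat (\<lambda>p. coeff p m) M $$ (i, p i))"
      using M permutes_in_image[OF p] by (intro prod.cong refl) auto
    then show "signof p * coeff (?f p) (n * m) =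
        signof p * (\<Prod>i = 0..<n. map_mat (\<lambda>p. coeff p m) M $$ (i, p i))"
      using b[OF p] by simp
  qed
qed

lemma lead_coeff_det_matpoly:
  assumes A: "A m \<in> carrier_mat n n" and det: "det (A m) \<noteq> 0"
  shows "lead_coeff (det (matpoly n m A)) = det (A m)"
proof -
  let ?P = "matpoly n m A"
  have P: "?P \<in> carrier_mat n n"
    by (simp add: matpoly_def)
  have deg: "degree (?P $$ (i, j)) \<le> m" if "i < n" "j < n" for i j
    using that
    by (auto simp: matpoly_def intro!: degree_sum_le intro: order_trans[OF degree_monom_le])
  have "map_mat (\<lambda>p. coeff p m) ?P = A m"
    using A by (intro eq_matI) (auto simp: matpoly_def coeff_sum)
  then have c: "coeff (det ?P) (n * m) = det (A m)"
    using degree_coeff_det_bound(2)[OF P deg] by simp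
  then have "degree (det ?P) = n * m"
    using degree_coeff_det_bound(1)[OF P deg] det by (metis le_antisym le_degree)
  then show ?thesis
    using c by simp
qed

text \<open>
  Split off the factor that belongs to \<open>i\<close>; by the product rule, the term that keeps it vanishes
  at \<open>l i\<close>. For a multiple root both sides are zero.
\<close>

lemma poly_pderiv_at_root:
  fixes p :: "complex poly"
  assumes J: "finite J" "i \<in> J" and roots: "proots p = image_mset l (mset_set J)"
  shows "poly (pderiv p) (l i) = lead_coeff p * (\<Prod>j\<in>J - {i}. l i - l j)"
proof -
  define q where "q = (\<Prod>j\<in>J - {i}. [:- l j, 1:])"
  have "p = smult (lead_coeff p) (\<Prod>x\<in>#proots p. [:- x, 1:])"
    by (rule complex_poly_decompose_multiset[symmetric])
  also have "(\<Prod>x\<in>#proots p. [:- x, 1:]) = (\<Prod>j\<in>J. [:- l j, 1:])"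
    by (simp add: roots prod_unfold_prod_mset image_mset.compositionality o_def)
  also have "\<dots> = [:- l i, 1:] * q"
    unfolding q_def using J by (rule prod.remove)
  finally have "pderiv p = pderiv (smult (lead_coeff p) ([:- l i, 1:] * q))"
    by (rule arg_cong)
  then show ?thesis
    by (simp add: pderiv_smult pderiv_mult pderiv_pCons q_def poly_prod del: mult_pCons_left)
qed

lemma poly_pderiv_nonzero_of_order_1:
  fixes p :: "'a::field_char_0 poly"
  assumes p: "p \<noteq> 0" and ord: "order z p = 1"
  shows "poly (pderiv p) z \<noteq> 0"
proof -
  have "degree p \<noteq> 0"
    using order_degree[OF p, of z] ord by simp
  then have "pderiv p \<noteq> 0"
    by (simp add: pderiv_eq_0_iff)
  then show ?thesis
    using p ord order_pderiv[of p z] order_root[of p z] order_root[of "pderiv p" z] by auto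
qed

section \<open>The condition number of a simple eigenvalue\<close>

theorem theorem8:
  fixes n m i :: nat
    and A :: "nat \<Rightarrow> complex mat"
    and w :: "nat \<Rightarrow> real"
    and l :: "nat \<Rightarrow> complex"
    and P :: "complex poly mat"
    and x y :: "complex vec"
  assumes "n \<ge> 1" and "m \<ge> 1"
    and "\<And>j. j \<le> m \<Longrightarrow> A j \<in> carrier_mat n n"
    and "det (A m) \<noteq> 0"
    and "w 0 > 0" and "\<And>j. 1 \<le> j \<Longrightarrow> j \<le> m \<Longrightarrow> w j \<ge> 0"
    and "P = matpoly n m A"
    and "matpoly_spectrum P = image_mset l (mset_set {1..n * m})"
    and "i \<in> {1..n * m}"
    and "matpoly_simple_eigenvalue P (l i)"
    and "right_eigenvector P (l i) x" and "left_eigenvector P (l i) y"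
  shows "cond_number m w P (l i) x y =
    weight_poly m w (cmod (l i)) * spectral_norm (adj_mat (matpoly_eval P (l i))) /
    (cmod (det (A m)) * (\<Prod>j\<in>{1..n * m} - {i}. cmod (l j - l i)))"
proof -
  define s where "s = conjugate y \<bullet> (matpoly_eval (matpoly_deriv P) (l i) *\<^sub>v x)"
  define d where "d = poly (pderiv (det P)) (l i)"
  have P: "P \<in> carrier_mat n n"
    using assms(7) by (simp add: matpoly_def)
  have ev: "matpoly_eigenvalue P (l i)"
    using assms(10) by (simp add: matpoly_simple_eigenvalue_def)
  have lead: "lead_coeff (det P) = det (A m)"
    using lead_coeff_det_matpoly[of A m n] assms(3,4,7) by simp
  have d0: "d \<noteq> 0"
  proof -
    have "det P \<noteq> 0"
      using assms(4) lead by (metis leading_coeff_0_iff)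
    then show ?thesis
      using assms(10) poly_pderiv_nonzero_of_order_1[of "det P" "l i"]
      by (simp add: matpoly_simple_eigenvalue_def d_def)
  qed
  have x: "x \<in> carrier_vec n" and y: "y \<in> carrier_vec n" "y \<noteq> 0\<^sub>v n"
    using assms(11,12) P by (auto simp: right_eigenvector_def left_eigenvector_def)
  have "adj_mat (matpoly_eval P (l i)) = mat n n (\<lambda>(r, c). d / s * x $ r * cnj (y $ c))"
    using adj_mat_simple_eigenvalue(2)[OF P ev _ assms(11,12)] d0 by (simp add: d_def s_def)
  then have norm_adj: "spectral_norm (adj_mat (matpoly_eval P (l i))) =
      cmod d / cmod s * vec_norm2 x * vec_norm2 y"
    using spectral_norm_rank_one[OF x y, of "d / s"] by (simp add: norm_divide)
  have "d = det (A m) * (\<Prod>j\<in>{1..n * m} - {i}. l i - l j)"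
    unfolding d_def using assms(8,9) lead
      poly_pderiv_at_root[of "{1..n * m}" i "det P" l]
    by (simp add: matpoly_spectrum_def)
  then have "cmod d = cmod (det (A m)) * (\<Prod>j\<in>{1..n * m} - {i}. cmod (l j - l i))"
    by (simp add: norm_mult prod_norm[symmetric] norm_minus_commute)
  then have denom: "cmod (det (A m)) * (\<Prod>j\<in>{1..n * m} - {i}. cmod (l j - l i)) = cmod d" ..
  show ?thesis
    unfolding cond_number_def norm_adj s_def[symmetric] denom using d0 by simp
qed

end
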